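(* Let $G$ be a connected bipartite graph with bipartition $(X,Y)$. If $G$ has an $|X|$-edge consecutive magic labeling, then $G$ is a tree having both a graceful labeling and a super edge-magic labeling.
   Context: Graphs are finite and simple, with vertex set $V(G)$ and edge set $E(G)$. An edge-magic total labeling (also called edge-magic labeling or magic valuation) of $G$ is a bijection $\lambda: V(G)\cup E(G)\to\{1,2,\ldots,|V(G)|+|E(G)|\}$ such that $\lambda(x)+\lambda(y)+\lambda(xy)$ is the same constant (the magic constant of $\lambda$) for all edges $xy\in E(G)$. For an integer $b$ with $0\le b\le |V(G)|$, a $b$-edge consecutive magic labeling of $G$ is an edge-magic total labeling $\lambda$ with $\lambda(E(G))=\{b+1,b+2,\ldots,b+|E(G)|\}$. A super edge-magic labeling of $G$ is a $b$-edge consecutive magic labeling with $b=|V(G)|$. A graceful labeling of a graph $G$ with $m$ edges is an injective map $\varphi:V(G)\to\{0,1,\ldots,m\}$ such that $\{|\varphi(x)-\varphi(y)| : xy\in E(G)\}=\{1,2,\ldots,m\}$. *)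

theory Defs
  imports Main
begin

text \<open>
  A graph is a pair of a vertex set and a set of two-element sets of vertices.
  The \<open>tree\<close> of the AFP entry Graph_Theory is not applicable here: in a symmetric digraph
  an edge and its reversal already form a cycle in the sense of that entry.
\<close>

locale simple_graph =
  fixes V :: "'a set" and E :: "'a set set"
  assumes finite_verts: "finite V"
    and edges: "e \<in> E \<Longrightarrow> e \<subseteq> V \<and> card e = 2"

definition bipartition :: "'a set \<Rightarrow> 'a set set \<Rightarrow> 'a set \<Rightarrow> 'a set \<Rightarrow> bool" where
  "bipartition V E X Y \<longleftrightarrow>
     X \<union> Y = V \<and> X \<inter> Y = {} \<and> (\<forall>e\<in>E. \<exists>x\<in>X. \<exists>y\<in>Y. e = {x, y})"

definition walk :: "'a set \<Rightarrow> 'a set set \<Rightarrow> 'a list \<Rightarrow> bool" where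
  "walk V E vs \<longleftrightarrow> vs \<noteq> [] \<and> set vs \<subseteq> V \<and> successively (\<lambda>u v. {u, v} \<in> E) vs"

definition connected_graph :: "'a set \<Rightarrow> 'a set set \<Rightarrow> bool" where
  "connected_graph V E \<longleftrightarrow>
     V \<noteq> {} \<and> (\<forall>u\<in>V. \<forall>v\<in>V. \<exists>vs. walk V E vs \<and> hd vs = u \<and> last vs = v)"

text \<open>A cycle is given by its distinct vertices in order; the closing edge joins last to first.\<close>

definition cycle :: "'a set \<Rightarrow> 'a set set \<Rightarrow> 'a list \<Rightarrow> bool" where
  "cycle V E vs \<longleftrightarrow>
     walk V E vs \<and> distinct vs \<and> length vs \<ge> 3 \<and> {last vs, hd vs} \<in> E"

definition tree :: "'a set \<Rightarrow> 'a set set \<Rightarrow> bool" where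
  "tree V E \<longleftrightarrow> simple_graph V E \<and> connected_graph V E \<and> (\<nexists>vs. cycle V E vs)"

text \<open>
  Vertices and edges have different types, so a labeling of both is a function on the
  disjoint sum: \<open>Inl x\<close> is the vertex \<open>x\<close> and \<open>Inr e\<close> is the edge \<open>e\<close>.
\<close>

definition edge_magic_total :: "'a set \<Rightarrow> 'a set set \<Rightarrow> ('a + 'a set \<Rightarrow> nat) \<Rightarrow> bool" where
  "edge_magic_total V E f \<longleftrightarrow>
     bij_betw f (V <+> E) {1..card V + card E} \<and>
     (\<exists>k. \<forall>x y. {x, y} \<in> E \<longrightarrow> f (Inl x) + f (Inl y) + f (Inr {x, y}) = k)"

definition edge_consecutive_magic ::
    "nat \<Rightarrow> 'a set \<Rightarrow> 'a set set \<Rightarrow> ('a + 'a set \<Rightarrow> nat) \<Rightarrow> bool" where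
  "edge_consecutive_magic b V E f \<longleftrightarrow>
     b \<le> card V \<and> edge_magic_total V E f \<and> f ` Inr ` E = {b + 1..b + card E}"

definition super_edge_magic :: "'a set \<Rightarrow> 'a set set \<Rightarrow> ('a + 'a set \<Rightarrow> nat) \<Rightarrow> bool" where
  "super_edge_magic V E f \<longleftrightarrow> edge_consecutive_magic (card V) V E f"

definition graceful :: "'a set \<Rightarrow> 'a set set \<Rightarrow> ('a \<Rightarrow> int) \<Rightarrow> bool" where
  "graceful V E g \<longleftrightarrow>
     inj_on g V \<and> g ` V \<subseteq> {0..int (card E)} \<and>
     {\<bar>g x - g y\<bar> | x y. {x, y} \<in> E} = {1..int (card E)}"

end

theory Submission
  imports Defs
begin

text \<open>
  Write \<open>n\<close> and \<open>m\<close> for the numbers of vertices and edges and \<open>b = |X|\<close>. The edges occupy the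
  labels \<open>b + 1, \<dots>, b + m\<close>, so the vertex labels split into a low block \<open>1, \<dots>, b\<close> and a high
  block \<open>b + m + 1, \<dots>, n + m\<close>. Because the labeling is magic and the edge labels are
  consecutive, the sums of end labels over the edges also form a block of \<open>m\<close> consecutive
  integers. A low-low sum, a mixed sum and a high-high sum lie in three ranges which, since
  \<open>m \<ge> n - 1\<close> by connectedness, are separated by gaps; hence only one kind of edge occurs
  (\<open>low_edge_imp_all_low\<close>, \<open>high_edge_imp_all_high\<close>). If there is an edge at all, then every
  vertex lies on one, and the kinds low-low and high-high would leave one of the two blocks
  unused; but the blocks have the sizes of \<open>X\<close> and \<open>Y\<close>, each of which contains an end of the
  edge. So all edges are mixed (\<open>edge_joins_low_high\<close>).

  Mixed sums take at most \<open>n - 1\<close> values, so \<open>m = n - 1\<close> and the graph is a tree; moreover every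
  value is attained, which fixes the magic constant as \<open>2 (b + m + 1)\<close> (\<open>tree_size_and_constant\<close>).
  Reversing the low block turns the sums of end labels into differences and gives the
  graceful labeling (\<open>graceful_by_reversal\<close>). Exchanging the block of edge labels with the high
  block keeps the edge sums constant, since each edge has exactly one high end, and gives
  the super edge-magic labeling (\<open>super_edge_magic_by_exchange\<close>).
\<close>

section \<open>Connectedness by cuts\<close>

text \<open>
  For a graph on at least one vertex this is connectedness. In this form it serves both to
  count edges and to see that a cycle edge can be deleted, without any surgery on walks.
\<close>

definition every_cut_crossed :: "'a set \<Rightarrow> 'a set set \<Rightarrow> bool" where
  "every_cut_crossed V E \<longleftrightarrow>
     (\<forall>S. S \<subset> V \<longrightarrow> S \<noteq> {} \<longrightarrow> (\<exists>u\<in>S. \<exists>v\<in>V - S. {u, v} \<in> E))"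

lemma list_crosses_set:
  assumes "vs \<noteq> []" "hd vs \<in> S" "last vs \<notin> S"
  shows "\<exists>i. Suc i < length vs \<and> vs ! i \<in> S \<and> vs ! Suc i \<notin> S"
  using assms
proof (induction vs)
  case (Cons a vs)
  show ?case
  proof (cases "vs \<noteq> [] \<and> hd vs \<in> S")
    case True
    then obtain i where "Suc i < length vs" "vs ! i \<in> S" "vs ! Suc i \<notin> S"
      using Cons by auto
    then show ?thesis by (intro exI[of _ "Suc i"]) auto
  next
    case False
    then show ?thesis using Cons.prems by (intro exI[of _ 0]) (cases vs; auto)
  qed
qed simp

lemma walk_crosses_cut:
  assumes "walk V E vs" "hd vs \<in> S" "last vs \<notin> S"
  obtains i where "Suc i < length vs" "vs ! i \<in> S" "vs ! Suc i \<in> V - S"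
    "{vs ! i, vs ! Suc i} \<in> E"
proof -
  have w: "vs \<noteq> []" "set vs \<subseteq> V" "successively (\<lambda>u v. {u, v} \<in> E) vs"
    using assms(1) by (auto simp: walk_def)
  obtain i where i: "Suc i < length vs" "vs ! i \<in> S" "vs ! Suc i \<notin> S"
    using list_crosses_set[OF w(1) assms(2,3)] by blast
  have "vs ! Suc i \<in> V" using w(2) i(1) nth_mem by blast
  moreover have "{vs ! i, vs ! Suc i} \<in> E" using w(3) i(1) by (simp add: successively_conv_nth)
  ultimately show thesis using that i by blast
qed

lemma connected_imp_every_cut_crossed:
  assumes "connected_graph V E"
  shows "every_cut_crossed V E"
  unfolding every_cut_crossed_def
proof (intro allI impI)
  fix S assume S: "S \<subset> V" "S \<noteq> {}"
  then obtain u v where "u \<in> S" "u \<in> V" "v \<in> V" "v \<notin> S" by blast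
  moreover from this obtain vs where "walk V E vs" "hd vs = u" "last vs = v"
    using assms unfolding connected_graph_def by blast
  ultimately show "\<exists>u\<in>S. \<exists>v\<in>V - S. {u, v} \<in> E"
    using walk_crosses_cut[of V E vs S] by metis
qed

text \<open>
  A set of vertices that spans enough edges is grown one vertex at a time; each step takes in
  the new edge that crosses the current cut.
\<close>

lemma card_verts_le_Suc_card_edges:
  assumes "finite V" "finite E" "V \<noteq> {}" "every_cut_crossed V E"
  shows "card V \<le> Suc (card E)"
proof -
  have grow: "\<exists>S F. S \<subseteq> V \<and> card S = Suc j \<and> F \<subseteq> E \<and> (\<forall>e\<in>F. e \<subseteq> S) \<and> card F = j"
    if "Suc j \<le> card V" for j
    using that
  proof (induction j)
    case 0
    obtain r where "r \<in> V" using assms(3) by blast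
    then show ?case by (intro exI[of _ "{r}"] exI[of _ "{}"]) auto
  next
    case (Suc j)
    then obtain S F where SF: "S \<subseteq> V" "card S = Suc j" "F \<subseteq> E" "\<forall>e\<in>F. e \<subseteq> S" "card F = j"
      by auto
    have "S \<subset> V" "S \<noteq> {}" using SF Suc.prems by auto
    then obtain u v where uv: "u \<in> S" "v \<in> V" "v \<notin> S" "{u, v} \<in> E"
      using assms(4) unfolding every_cut_crossed_def by blast
    have fin: "finite S" "finite F"
      using SF(1,3) assms(1,2) finite_subset by blast+
    have "{u, v} \<notin> F" using SF(4) uv(3) by blast
    then have "card (insert {u, v} F) = Suc j" using SF(5) fin by simp
    moreover have "card (insert v S) = Suc (Suc j)" using SF(2) uv(3) fin by simp
    moreover have "\<forall>e\<in>insert {u, v} F. e \<subseteq> insert v S" using SF(4) uv(1) by auto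
    ultimately show ?case
      using SF(1,3) uv(2,4)
      by (intro exI[of _ "insert v S"] exI[of _ "insert {u, v} F"]) simp
  qed
  have "card V > 0" using assms(1,3) by (simp add: card_gt_0_iff)
  then obtain F where "F \<subseteq> E" "card F = card V - 1" using grow[of "card V - 1"] by auto
  then have "card V - 1 \<le> card E" using card_mono[OF assms(2)] by metis
  then show ?thesis by simp
qed

text \<open>
  A cut that separates the ends of a cycle's closing edge is also crossed by the rest of the
  cycle.
\<close>

lemma every_cut_crossed_without_closing_edge:
  assumes "cycle V E vs" "every_cut_crossed V E"
  shows "every_cut_crossed V (E - {{last vs, hd vs}})"
  unfolding every_cut_crossed_def
proof (intro allI impI)
  fix S assume S: "S \<subset> V" "S \<noteq> {}"
  let ?e = "{last vs, hd vs}"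
  have w: "walk V E vs" "distinct vs" "length vs \<ge> 3"
    using assms(1) by (auto simp: cycle_def)
  then have ne: "vs \<noteq> []" by auto
  have not_closing: "{vs ! i, vs ! Suc i} \<noteq> ?e" if "Suc i < length vs" for i
  proof
    assume "{vs ! i, vs ! Suc i} = ?e"
    then have "{vs ! i, vs ! Suc i} = {vs ! (length vs - 1), vs ! 0}"
      using ne by (simp add: last_conv_nth hd_conv_nth)
    moreover have "i < length vs" "length vs - 1 < length vs" "0 < length vs"
      using w(3) that by auto
    ultimately have "{i, Suc i} = {length vs - 1, 0}"
      using w(2) that by (simp only: doubleton_eq_iff nth_eq_iff_index_eq)
    then show False using w(3) by (auto simp: doubleton_eq_iff)
  qed
  obtain u v where uv: "u \<in> S" "v \<in> V - S" "{u, v} \<in> E"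
    using assms(2) S unfolding every_cut_crossed_def by blast
  show "\<exists>u\<in>S. \<exists>v\<in>V - S. {u, v} \<in> E - {?e}"
  proof (cases "{u, v} = ?e")
    case False
    then show ?thesis using uv by blast
  next
    case True
    then consider "hd vs \<in> S" "last vs \<notin> S" | "last vs \<in> S" "hd vs \<in> V - S"
      using uv by (auto simp: doubleton_eq_iff)
    then show ?thesis
    proof cases
      case 1
      then obtain i where "Suc i < length vs" "vs ! i \<in> S" "vs ! Suc i \<in> V - S"
        "{vs ! i, vs ! Suc i} \<in> E"
        using walk_crosses_cut[OF w(1)] by blast
      then show ?thesis using not_closing by blast
    next
      case 2
      then obtain i where i: "Suc i < length vs" "vs ! i \<in> V - S" "vs ! Suc i \<in> V - (V - S)"
        "{vs ! i, vs ! Suc i} \<in> E"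
        using walk_crosses_cut[OF w(1), of "V - S"] by blast
      then have "{vs ! Suc i, vs ! i} \<in> E - {?e}" "vs ! Suc i \<in> S"
        using not_closing[of i] by (auto simp: insert_commute)
      then show ?thesis using i(2) by blast
    qed
  qed
qed

lemma (in simple_graph) finite_edges: "finite E"
  by (rule finite_subset[of _ "Pow V"]) (use edges finite_verts in auto)

text \<open>
  Deleting a cycle edge would leave a connected graph with too few edges for its vertices.
\<close>

lemma (in simple_graph) tree_if_few_edges:
  assumes conn: "connected_graph V E" and few: "card E < card V"
  shows "tree V E"
proof -
  have "\<not> cycle V E vs" for vs
  proof
    assume cyc: "cycle V E vs"
    have "V \<noteq> {}" using conn by (simp add: connected_graph_def)
    then have "card V \<le> Suc (card (E - {{last vs, hd vs}}))"
      using card_verts_le_Suc_card_edges finite_verts finite_edges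
        every_cut_crossed_without_closing_edge[OF cyc connected_imp_every_cut_crossed[OF conn]]
      by (metis finite_Diff)
    moreover have "{last vs, hd vs} \<in> E" using cyc by (simp add: cycle_def)
    ultimately show False
      using few card_Diff1_less[OF finite_edges] by fastforce
  qed
  then show ?thesis using conn simple_graph_axioms by (auto simp: tree_def)
qed

section \<open>Edge consecutive magic labelings of connected graphs\<close>

locale connected_consecutive_magic = simple_graph V E
  for V :: "'a set" and E :: "'a set set" +
  fixes f :: "'a + 'a set \<Rightarrow> nat" and b k :: nat
  assumes conn: "connected_graph V E"
    and b_le: "b \<le> card V"
    and bij: "bij_betw f (V <+> E) {1..card V + card E}"
    and magic: "{x, y} \<in> E \<Longrightarrow> f (Inl x) + f (Inl y) + f (Inr {x, y}) = k"
    and edge_labels: "f ` Inr ` E = {b + 1..b + card E}"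
begin

lemma card_verts_le: "card V \<le> Suc (card E)"
  using card_verts_le_Suc_card_edges[OF finite_verts finite_edges _
      connected_imp_every_cut_crossed[OF conn]] conn
  by (simp add: connected_graph_def)

lemma edge_ends: "{x, y} \<in> E \<Longrightarrow> x \<in> V \<and> y \<in> V \<and> x \<noteq> y"
  using edges[of "{x, y}"] by (cases "x = y") auto

lemma edge_ends_exist:
  assumes "e \<in> E"
  obtains x y where "e = {x, y}"
  using edges[OF assms] by (auto simp: card_2_iff)

lemma inj_vertex_label: "inj_on (\<lambda>v. f (Inl v)) V"
  using bij by (auto simp: bij_betw_def inj_on_def)

lemma vertex_label:
  assumes "v \<in> V"
  shows "1 \<le> f (Inl v)" "f (Inl v) \<le> card V + card E"
    "f (Inl v) \<le> b \<or> b + card E < f (Inl v)"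
proof -
  have "f (Inl v) \<in> {1..card V + card E}"
    using assms by (intro bij_betw_apply[OF bij]) auto
  then show "1 \<le> f (Inl v)" "f (Inl v) \<le> card V + card E" by auto
  have "f (Inl v) \<notin> f ` Inr ` E"
  proof
    assume "f (Inl v) \<in> f ` Inr ` E"
    then obtain e where "e \<in> E" "f (Inl v) = f (Inr e)" by auto
    then have "Inl v = Inr e" using bij assms by (auto simp: bij_betw_def dest!: inj_onD)
    then show False by simp
  qed
  then show "f (Inl v) \<le> b \<or> b + card E < f (Inl v)" unfolding edge_labels by auto
qed

lemma edge_label:
  assumes "e \<in> E"
  shows "b + 1 \<le> f (Inr e)" "f (Inr e) \<le> b + card E"
proof -
  have "f (Inr e) \<in> f ` Inr ` E" using assms by blast
  then show "b + 1 \<le> f (Inr e)" "f (Inr e) \<le> b + card E" unfolding edge_labels by auto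
qed

lemma end_label_neq: "{x, y} \<in> E \<Longrightarrow> f (Inl x) \<noteq> f (Inl y)"
  using edge_ends inj_vertex_label by (auto dest: inj_onD)

lemma edge_with_label:
  assumes "b + 1 \<le> l" "l \<le> b + card E"
  obtains x y where "{x, y} \<in> E" "f (Inr {x, y}) = l" "f (Inl x) + f (Inl y) + l = k"
proof -
  have "l \<in> f ` Inr ` E" using assms edge_labels by simp
  then obtain e where e: "e \<in> E" "f (Inr e) = l" by auto
  then obtain x y where "e = {x, y}" using edge_ends_exist by blast
  then show thesis using that e magic by metis
qed

text \<open>The edge labels are consecutive, so the sums of end labels have no gap either.\<close>

lemma end_sums_have_no_gap:
  assumes "{x, y} \<in> E" "{x', y'} \<in> E"
    and "f (Inl x) + f (Inl y) \<le> s" "s \<le> f (Inl x') + f (Inl y')"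
  obtains u v where "{u, v} \<in> E" "f (Inl u) + f (Inl v) = s"
proof -
  have "b + 1 \<le> k - s" "k - s \<le> b + card E" "s \<le> k"
    using magic[OF assms(1)] magic[OF assms(2)] edge_label[OF assms(1)] edge_label[OF assms(2)]
      assms(3,4) by linarith+
  then show thesis using edge_with_label[of "k - s"] that by (metis add.commute add_left_cancel le_add_diff_inverse)
qed

text \<open>
  The end labels of an edge are distinct, so two low ones have a sum below \<open>2 b\<close>, while every
  edge with a high end has a sum above \<open>2 b\<close>: the value \<open>2 b\<close> itself lies in the gap.
\<close>

lemma low_edge_imp_all_low:
  assumes "{x, y} \<in> E" "f (Inl x) \<le> b" "f (Inl y) \<le> b" and "{u, v} \<in> E"
  shows "f (Inl u) \<le> b"
proof (rule ccontr)
  assume "\<not> f (Inl u) \<le> b"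
  have off_gap: "f (Inl s) + f (Inl t) \<noteq> 2 * b"
    and high: "\<not> f (Inl s) \<le> b \<Longrightarrow> 2 * b < f (Inl s) + f (Inl t)" if "{s, t} \<in> E" for s t
  proof -
    have "s \<in> V" "t \<in> V" using edge_ends[OF that] by auto
    note labels = end_label_neq[OF that] vertex_label[OF this(1)] vertex_label[OF this(2)]
      card_verts_le b_le
    show "f (Inl s) + f (Inl t) \<noteq> 2 * b" using labels by linarith
    show "2 * b < f (Inl s) + f (Inl t)" if "\<not> f (Inl s) \<le> b" using labels that by linarith
  qed
  have "f (Inl x) + f (Inl y) \<le> 2 * b" using assms by linarith
  moreover have "2 * b \<le> f (Inl u) + f (Inl v)"
    using high[OF assms(4)] \<open>\<not> f (Inl u) \<le> b\<close> by linarith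
  ultimately obtain s t where "{s, t} \<in> E" "f (Inl s) + f (Inl t) = 2 * b"
    using end_sums_have_no_gap[OF assms(1,4)] by blast
  then show False using off_gap by blast
qed

text \<open>Here the value in the gap is twice the least high label.\<close>

lemma high_edge_imp_all_high:
  assumes "{x, y} \<in> E" "b < f (Inl x)" "b < f (Inl y)" and "{u, v} \<in> E"
  shows "b < f (Inl u)"
proof (rule ccontr)
  let ?g = "2 * b + 2 * card E + 2"
  assume "\<not> b < f (Inl u)"
  have off_gap: "f (Inl s) + f (Inl t) \<noteq> ?g"
    and low: "f (Inl s) \<le> b \<Longrightarrow> f (Inl s) + f (Inl t) < ?g" if "{s, t} \<in> E" for s t
  proof -
    have "s \<in> V" "t \<in> V" using edge_ends[OF that] by auto
    note labels = end_label_neq[OF that] vertex_label[OF this(1)] vertex_label[OF this(2)]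
      card_verts_le b_le
    show "f (Inl s) + f (Inl t) \<noteq> ?g" using labels by linarith
    show "f (Inl s) + f (Inl t) < ?g" if "f (Inl s) \<le> b" using labels that by linarith
  qed
  have "?g \<le> f (Inl x) + f (Inl y)"
    using assms vertex_label[of x] vertex_label[of y] edge_ends[OF assms(1)] by linarith
  moreover have "f (Inl u) + f (Inl v) \<le> ?g"
    using low[OF assms(4)] \<open>\<not> b < f (Inl u)\<close> by linarith
  ultimately obtain s t where "{s, t} \<in> E" "f (Inl s) + f (Inl t) = ?g"
    using end_sums_have_no_gap[OF assms(4,1)] by blast
  then show False using off_gap by blast
qed

lemma vertex_on_edge:
  assumes "E \<noteq> {}" "v \<in> V"
  obtains w where "{v, w} \<in> E"
proof -
  obtain x y where "{x, y} \<in> E" using assms(1) edge_ends_exist by blast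
  then have "{v} \<subset> V" using edge_ends[of x y] assms(2) by blast
  then show thesis
    using connected_imp_every_cut_crossed[OF conn] that unfolding every_cut_crossed_def by blast
qed

lemma edge_joins_low_high:
  assumes "0 < b" "b < card V" and edge: "{x, y} \<in> E"
  shows "f (Inl x) \<le> b \<and> b < f (Inl y) \<or> f (Inl y) \<le> b \<and> b < f (Inl x)"
proof (rule ccontr)
  assume "\<not> ?thesis"
  then consider "f (Inl x) \<le> b" "f (Inl y) \<le> b" | "b < f (Inl x)" "b < f (Inl y)" by linarith
  then show False
  proof cases
    case 1
    have "f (Inl v) \<in> {1..b}" if "v \<in> V" for v
      using vertex_on_edge[of v] low_edge_imp_all_low[OF edge 1] vertex_label(1)[of v] that edge
      by (metis atLeastAtMost_iff empty_iff)
    then have "card V \<le> card {1..b}"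
      using inj_vertex_label by (intro card_inj_on_le) auto
    then show False using assms(2) by simp
  next
    case 2
    have "f (Inl v) \<in> {b + card E + 1..card V + card E}" if v: "v \<in> V" for v
    proof -
      obtain w where "{v, w} \<in> E" using vertex_on_edge[of v] v edge by blast
      then have "b < f (Inl v)" using high_edge_imp_all_high[OF edge 2] by blast
      then show ?thesis using vertex_label[OF v] by simp
    qed
    then have "card V \<le> card {b + card E + 1..card V + card E}"
      using inj_vertex_label by (intro card_inj_on_le) auto
    then show False using assms(1,2) by simp
  qed
qed

end

section \<open>Labelings in which every edge joins the low to the high block\<close>

text \<open>The one-vertex graph satisfies the assumption vacuously, so the results of this section cover
  it, although its only label may be low or high and its magic constant is arbitrary.\<close>

locale separating_consecutive_magic = connected_consecutive_magic V E f b k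
  for V :: "'a set" and E :: "'a set set" and f b k +
  assumes low_high: "{x, y} \<in> E \<Longrightarrow>
    f (Inl x) \<le> b \<and> b < f (Inl y) \<or> f (Inl y) \<le> b \<and> b < f (Inl x)"
begin

lemma oriented_edge:
  assumes "{x, y} \<in> E"
  obtains u v where "{x, y} = {u, v}" "{u, v} \<in> E" "u \<in> V" "v \<in> V"
    "f (Inl u) \<le> b" "b + card E < f (Inl v)"
proof (cases "f (Inl x) \<le> b")
  case True
  then show thesis
    using that[of x y] low_high[OF assms] edge_ends[OF assms] assms vertex_label(3)[of y]
    by auto
next
  case False
  have "{y, x} = {x, y}" by auto
  then show thesis
    using that[of y x] low_high[OF assms] edge_ends[OF assms] assms False vertex_label(3)[of x]
    by auto
qed

text \<open>
  The edges labeled \<open>b + 1\<close> and \<open>b + card E\<close> have the largest and the smallest sum of end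
  labels, and mixed sums range over \<open>card V - 1\<close> values only. Together with connectedness this
  leaves no slack in either inequality.
\<close>

lemma tree_size_and_constant:
  shows "card V = Suc (card E)" and "E \<noteq> {} \<Longrightarrow> k = 2 * b + 2 * card E + 2"
proof -
  have "card V = Suc (card E) \<and> k = 2 * b + 2 * card E + 2" if "E \<noteq> {}"
  proof -
    have m: "card E > 0" using that finite_edges by (simp add: card_gt_0_iff)
    have range: "b + card E + 2 \<le> f (Inl x) + f (Inl y)"
      "f (Inl x) + f (Inl y) \<le> b + card V + card E" if "{x, y} \<in> E" for x y
      using low_high[OF that] edge_ends[OF that] vertex_label[of x] vertex_label[of y]
      by linarith+
    obtain x y where xy: "{x, y} \<in> E" "f (Inl x) + f (Inl y) + (b + 1) = k"
      by (rule edge_with_label[of "b + 1"]) (use m in auto)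
    obtain x' y' where xy': "{x', y'} \<in> E" "f (Inl x') + f (Inl y') + (b + card E) = k"
      by (rule edge_with_label[of "b + card E"]) (use m in auto)
    show ?thesis
      using range[OF xy(1)] range[OF xy'(1)] xy(2) xy'(2) card_verts_le
      by (intro conjI) linarith+
  qed
  moreover have "card V = Suc (card E)" if "E = {}"
  proof -
    have "card V > 0"
      using conn finite_verts by (simp add: connected_graph_def card_gt_0_iff)
    then show ?thesis using card_verts_le that by simp
  qed
  ultimately show "card V = Suc (card E)" and "E \<noteq> {} \<Longrightarrow> k = 2 * b + 2 * card E + 2"
    by blast+
qed

text \<open>
  Reversing the low block to \<open>b - 1, \<dots>, 0\<close> and moving the high block down to start at \<open>b\<close> makes
  the difference along an edge equal to its end sum minus \<open>b + card E + 1\<close>, which by the value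
  of the magic constant is \<open>b + card E + 1\<close> minus the edge label.
\<close>

lemma graceful_by_reversal:
  "graceful V E (\<lambda>v. if f (Inl v) \<le> b then int b - int (f (Inl v))
     else int (f (Inl v)) - int (card E) - 1)" (is "graceful V E ?g")
  unfolding graceful_def
proof (intro conjI)
  note size = tree_size_and_constant(1)
  show "inj_on ?g V"
  proof (rule inj_onI)
    fix x y assume xy: "x \<in> V" "y \<in> V" "?g x = ?g y"
    then have "f (Inl x) = f (Inl y)"
      using vertex_label[OF xy(1)] vertex_label[OF xy(2)] by (auto split: if_splits)
    then show "x = y" using inj_vertex_label xy by (auto dest: inj_onD)
  qed
  show "?g ` V \<subseteq> {0..int (card E)}"
  proof
    fix z assume "z \<in> ?g ` V"
    then obtain v where "v \<in> V" "z = ?g v" by blast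
    then show "z \<in> {0..int (card E)}"
      using vertex_label[of v] b_le size by auto
  qed
  have diff: "\<bar>?g x - ?g y\<bar> = int (b + card E + 1) - int (f (Inr {x, y}))"
    if e: "{x, y} \<in> E" for x y
  proof -
    have "f (Inl x) + f (Inl y) + f (Inr {x, y}) = 2 * b + 2 * card E + 2"
      using magic[OF e] tree_size_and_constant(2) e by auto
    then show ?thesis
      using low_high[OF e] edge_label(2)[OF e] by auto
  qed
  show "{\<bar>?g x - ?g y\<bar> |x y. {x, y} \<in> E} = {1..int (card E)}"
  proof
    show "{\<bar>?g x - ?g y\<bar> |x y. {x, y} \<in> E} \<subseteq> {1..int (card E)}"
      using diff edge_label by fastforce
    show "{1..int (card E)} \<subseteq> {\<bar>?g x - ?g y\<bar> |x y. {x, y} \<in> E}"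
    proof
      fix d assume d: "d \<in> {1..int (card E)}"
      then have "b + 1 \<le> b + card E + 1 - nat d" "b + card E + 1 - nat d \<le> b + card E"
        by auto
      then obtain x y where xy: "{x, y} \<in> E" "f (Inr {x, y}) = b + card E + 1 - nat d"
        using edge_with_label by metis
      have "\<bar>?g x - ?g y\<bar> = d" unfolding diff[OF xy(1)] xy(2) using d by auto
      then show "d \<in> {\<bar>?g x - ?g y\<bar> |x y. {x, y} \<in> E}" using xy(1) by blast
    qed
  qed
qed

definition exchange :: "nat \<Rightarrow> nat" where
  "exchange t = (if t \<le> b then t
     else if t \<le> b + card E then t + (card V - b) else t - card E)"

lemma bij_betw_exchange: "bij_betw exchange {1..card V + card E} {1..card V + card E}"
proof (rule bij_betw_byWitness[where f' = "\<lambda>t. if t \<le> b then t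
     else if t \<le> card V then t + card E else t - (card V - b)"])
qed (use b_le in \<open>auto simp: exchange_def split: if_splits\<close>)

text \<open>
  Along an edge the low label stays, the high label drops by \<open>card E\<close> and the edge label grows
  by \<open>card V - b\<close>, so the magic sum changes by the same amount for all edges.
\<close>

lemma super_edge_magic_by_exchange: "super_edge_magic V E (exchange \<circ> f)"
proof -
  have edge_ex: "exchange (f (Inr e)) = f (Inr e) + (card V - b)" if "e \<in> E" for e
    using edge_label[OF that] by (simp add: exchange_def)
  have const: "exchange (f (Inl x)) + exchange (f (Inl y)) + exchange (f (Inr {x, y}))
      = k - card E + (card V - b)" if e: "{x, y} \<in> E" for x y
    unfolding edge_ex[OF e] using e
    by (rule oriented_edge) (use magic[OF e] in \<open>auto simp: exchange_def doubleton_eq_iff\<close>)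
  have "(exchange \<circ> f) ` Inr ` E = (\<lambda>t. t + (card V - b)) ` (f ` Inr ` E)"
    using edge_ex by (force simp: image_iff)
  also have "\<dots> = {card V + 1..card V + card E}"
    unfolding edge_labels image_add_atLeastAtMost' using b_le by simp
  finally have "(exchange \<circ> f) ` Inr ` E = {card V + 1..card V + card E}" .
  then show ?thesis
    using bij_betw_trans[OF bij bij_betw_exchange] const
    by (auto simp: super_edge_magic_def edge_consecutive_magic_def edge_magic_total_def)
qed

end

section \<open>Connected bipartite graphs\<close>

theorem theorem4:
  fixes V X Y :: "'a set" and E :: "'a set set"
  assumes "simple_graph V E"
    and "connected_graph V E"
    and "bipartition V E X Y"
    and "\<exists>f. edge_consecutive_magic (card X) V E f"
  shows "tree V E \<and> (\<exists>g. graceful V E g) \<and> (\<exists>h. super_edge_magic V E h)"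
proof -
  interpret simple_graph V E by fact
  obtain f k where "connected_consecutive_magic V E f (card X) k"
    using assms(1,2,4)
    by (auto simp: edge_consecutive_magic_def edge_magic_total_def
        connected_consecutive_magic_def connected_consecutive_magic_axioms_def)
  then interpret connected_consecutive_magic V E f "card X" k .
  have "0 < card X \<and> card X < card V" if "E \<noteq> {}"
  proof -
    have "X \<noteq> {}" "Y \<noteq> {}" "X \<union> Y = V" "X \<inter> Y = {}"
      using assms(3) that by (auto simp: bipartition_def)
    then have "X \<subset> V" "X \<noteq> {}" by auto
    then show ?thesis
      using finite_verts by (meson card_gt_0_iff finite_subset psubset_card_mono psubset_imp_subset)
  qed
  then interpret separating_consecutive_magic V E f "card X" k
    using edge_joins_low_high by unfold_locales blast
  show ?thesis
    using tree_if_few_edges[OF conn] tree_size_and_constant(1) graceful_by_reversal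
      super_edge_magic_by_exchange by auto
qed

end
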